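(* Let $T=(V,E)$ and $T'=(V,E')$ be two tournaments on the same set $V$ of $v$ vertices. Let $p$ be a prime number and $k$ an integer with $2\leq k\leq v-2$. Let $G:=T\dot{+}T'$. Assume that for all $k$-element subsets $K$ of $V$, $e(G_{\restriction K})\equiv 0 \pmod p$. 1) If $p\geq 3$ and $k\not\equiv 0,1\pmod p$, then $T'=T$. 2) If $p\geq 3$ and $k\equiv 0 \pmod p$, then $T'=T$ or $T'=T^*$. 3) If $p=2$ and $k\equiv 2\pmod 4$, then $T'=T$. 4) If $p=2$ and $k\equiv 0 \pmod 4$, then $T'=T$ or $T'=T^*$.
   Context: A tournament $T=(V,E)$ has, for every two distinct vertices $x,y$, exactly one of $(x,y),(y,x)$ in $E$. The dual $T^*$ is $(V,E^* )$ with $(x,y)\in E^*$ iff $(y,x)\in E$. The boolean sum $T\dot{+}T'$ of tournaments $T=(V,E)$, $T'=(V,E')$ is the graph on $V$ whose edges are the pairs $\{x,y\}$ such that $(x,y)\in E$ iff $(x,y)\notin E'$. For a graph $G$, $G_{\restriction K}$ is the induced subgraph on $K$ and $e(\cdot)$ counts edges. *)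

theory Defs
  imports "Graph_Theory.Pair_Digraph" "HOL-Library.Ramsey" "HOL-Number_Theory.Cong"
begin

text \<open>
  Tournaments are finite and loop-free (through \<^locale>\<open>pair_digraph\<close>), so that the arc set is
  determined by the pairs of distinct vertices and equality of tournaments on the same vertex set is
  equality of records.
\<close>

locale tournament = pair_digraph T for T :: "'a pair_pre_digraph" +
  assumes exactly_one_arc:
    "\<lbrakk>x \<in> pverts T; y \<in> pverts T; x \<noteq> y\<rbrakk> \<Longrightarrow> (x, y) \<in> parcs T \<longleftrightarrow> (y, x) \<notin> parcs T"

definition dual :: "'a pair_pre_digraph \<Rightarrow> 'a pair_pre_digraph" where
  "dual T = \<lparr> pverts = pverts T, parcs = (parcs T)\<inverse> \<rparr>"

text \<open>
  Simple undirected graphs have two-element vertex sets as edges, so that \<open>num_edges\<close> counts each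
  edge once; in the symmetric digraphs \<^locale>\<open>pair_graph\<close> each edge would be two arcs.
\<close>

record 'a ugraph =
  uverts :: "'a set"
  uedges :: "'a set set"

definition simple_graph :: "'a ugraph \<Rightarrow> bool" where
  "simple_graph G \<longleftrightarrow> uedges G \<subseteq> [uverts G]\<^bsup>2\<^esup>"

definition induced :: "'a ugraph \<Rightarrow> 'a set \<Rightarrow> 'a ugraph" where
  "induced G K = \<lparr> uverts = uverts G \<inter> K, uedges = uedges G \<inter> [K]\<^bsup>2\<^esup> \<rparr>"

definition num_edges :: "'a ugraph \<Rightarrow> nat" where
  "num_edges G = card (uedges G)"

text \<open>Only meaningful for tournaments with the same vertex set.\<close>

definition boolean_sum :: "'a pair_pre_digraph \<Rightarrow> 'a pair_pre_digraph \<Rightarrow> 'a ugraph" where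
  "boolean_sum T T' =
    \<lparr> uverts = pverts T,
      uedges = {{x, y} | x y. x \<in> pverts T \<and> y \<in> pverts T \<and> x \<noteq> y \<and>
                              ((x, y) \<in> parcs T \<longleftrightarrow> (x, y) \<notin> parcs T')} \<rparr>"

lemma simple_graph_boolean_sum: "simple_graph (boolean_sum T T')"
  by (auto simp: simple_graph_def boolean_sum_def)

text \<open>The edge condition does not depend on the order in which the two vertices are taken.\<close>

lemma boolean_sum_edge_iff:
  assumes "tournament T" "tournament T'" "pverts T' = pverts T"
    and "x \<in> pverts T" "y \<in> pverts T" "x \<noteq> y"
  shows "{x, y} \<in> uedges (boolean_sum T T') \<longleftrightarrow> ((x, y) \<in> parcs T \<longleftrightarrow> (x, y) \<notin> parcs T')"
proof -
  have "(x, y) \<in> parcs T \<longleftrightarrow> (y, x) \<notin> parcs T"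
    using tournament.exactly_one_arc[OF assms(1)] assms by blast
  moreover have "(x, y) \<in> parcs T' \<longleftrightarrow> (y, x) \<notin> parcs T'"
    using tournament.exactly_one_arc[OF assms(2)] assms by metis
  ultimately show ?thesis
    using assms(4-6) by (auto simp: boolean_sum_def doubleton_eq_iff)
qed

lemma tournament_dual:
  assumes "tournament T"
  shows "tournament (dual T)"
proof -
  interpret tournament T by (rule assms)
  show ?thesis
  proof
    show "fst e \<in> pverts (dual T)" if "e \<in> parcs (dual T)" for e
      using that by (auto simp: dual_def dest: in_arcsD2)
    show "snd e \<in> pverts (dual T)" if "e \<in> parcs (dual T)" for e
      using that by (auto simp: dual_def dest: in_arcsD1)
    show "finite (pverts (dual T))" and "finite (parcs (dual T))"
      by (simp_all add: dual_def)
    show "fst e \<noteq> snd e" if "e \<in> parcs (dual T)" for e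
      using that by (auto simp: dual_def dest: pair_no_loops)
    show "(x, y) \<in> parcs (dual T) \<longleftrightarrow> (y, x) \<notin> parcs (dual T)"
      if "x \<in> pverts (dual T)" "y \<in> pverts (dual T)" "x \<noteq> y" for x y
      using that exactly_one_arc[of y x] by (simp add: dual_def)
  qed
qed

end

theory Submission
  imports Defs
begin

text \<open>
  Write \<open>w x y\<close> for the edge indicator of \<open>G\<close>. Exchanging a vertex \<open>a\<close> of a \<open>k\<close>-set for a
  vertex \<open>b\<close> outside it shows that \<open>w a y - w b y\<close>, summed over any \<open>(k - 1)\<close>-set of vertices \<open>y\<close>
  avoiding \<open>a\<close> and \<open>b\<close>, vanishes modulo \<open>p\<close>. Exchanging one of the \<open>y\<close> in turn shows that
  \<open>w a y - w b y\<close> is independent of \<open>y\<close> modulo \<open>p\<close>, so that its product with \<open>k - 1\<close> vanishes.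
  In all four cases \<open>k - 1\<close> is invertible modulo \<open>p\<close>; hence \<open>w a y = w b y\<close> and \<open>G\<close> is empty or
  complete. A complete \<open>G\<close> is excluded in cases 1 and 3 because \<open>k choose 2\<close> is not divisible
  by \<open>p\<close>.
\<close>

text \<open>The edges gained are the \<open>{x, y}\<close> with \<open>y\<close> a neighbour of
  \<open>x\<close> in \<open>S\<close>. Counting in \<open>int\<close> allows two such counts to be
  subtracted.\<close>

lemma num_edges_induced_insert:
  assumes "finite S" "x \<notin> S"
  shows "int (num_edges (induced G (insert x S))) =
    int (num_edges (induced G S)) + (\<Sum>y\<in>S. of_bool ({x, y} \<in> uedges G))"
proof -
  let ?E = "uedges G"
  let ?N = "{y \<in> S. {x, y} \<in> ?E}"
  have split: "?E \<inter> [insert x S]\<^bsup>2\<^esup> = (?E \<inter> [S]\<^bsup>2\<^esup>) \<union> (\<lambda>y. {x, y}) ` ?N"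
    using assms(2) by (auto simp: nsets_2_eq doubleton_eq_iff image_iff insert_commute)
  have "inj_on (\<lambda>y. {x, y}) ?N"
    by (auto simp: inj_on_def doubleton_eq_iff)
  moreover have "finite (?E \<inter> [S]\<^bsup>2\<^esup>)"
    using assms(1) by (simp add: finite_imp_finite_nsets)
  moreover have "(?E \<inter> [S]\<^bsup>2\<^esup>) \<inter> (\<lambda>y. {x, y}) ` ?N = {}"
    using assms(2) by (auto simp: nsets_def)
  ultimately have "card (?E \<inter> [insert x S]\<^bsup>2\<^esup>) = card (?E \<inter> [S]\<^bsup>2\<^esup>) + card ?N"
    using assms(1) unfolding split by (subst card_Un_disjoint) (auto simp: card_image)
  moreover have "int (card ?N) = (\<Sum>y\<in>S. of_bool ({x, y} \<in> ?E))"
    using assms(1) by (simp add: sum.If_cases of_bool_def Int_def)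
  ultimately show ?thesis
    by (simp add: num_edges_def induced_def)
qed

lemma empty_or_complete_if_induced_edges_cong_0:
  fixes G :: "'a ugraph" and k p :: nat
  assumes "simple_graph G" "finite (uverts G)"
    and "2 \<le> k" "k + 2 \<le> card (uverts G)" "1 < p" "coprime (k - 1) p"
    and cong_0: "\<And>K. \<lbrakk>K \<subseteq> uverts G; card K = k\<rbrakk> \<Longrightarrow> [num_edges (induced G K) = 0] (mod p)"
  shows "uedges G = {} \<or> uedges G = [uverts G]\<^bsup>2\<^esup>"
proof -
  define V where "V = uverts G"
  define w :: "'a \<Rightarrow> 'a \<Rightarrow> int" where "w x y = of_bool ({x, y} \<in> uedges G)" for x y
  have w_commute: "w x y = w y x" for x y
    by (simp add: w_def insert_commute)
  have finV: "finite V"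
    using assms(2) by (simp add: V_def)
  have exchange: "[(\<Sum>y\<in>S. w a y - w b y) = 0] (mod int p)"
    if S: "S \<subseteq> V - {a, b}" "card S = k - 1" and ab: "a \<in> V" "b \<in> V" for a b S
  proof -
    have finS: "finite S"
      using S(1) finV finite_subset by blast
    \<comment> \<open>Both \<open>insert a S\<close> and \<open>insert b S\<close> are
      \<open>k\<close>-sets; subtracting their edge counts cancels the edges inside
      \<open>S\<close>.\<close>
    have "int p dvd int (num_edges (induced G S)) + (\<Sum>y\<in>S. w x y)" if "x \<in> {a, b}" for x
    proof -
      have "x \<notin> S" "insert x S \<subseteq> V"
        using that S ab by auto
      moreover from this have "card (insert x S) = k"
        using S(2) finS assms(3) by simp
      ultimately have "[num_edges (induced G (insert x S)) = 0] (mod p)"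
        using cong_0 V_def by blast
      then have "int p dvd int (num_edges (induced G (insert x S)))"
        by (simp add: cong_0_iff)
      then show ?thesis
        using num_edges_induced_insert[OF finS \<open>x \<notin> S\<close>, of G] by (simp add: w_def)
    qed
    then have "int p dvd (int (num_edges (induced G S)) + (\<Sum>y\<in>S. w a y)) -
        (int (num_edges (induced G S)) + (\<Sum>y\<in>S. w b y))"
      by (intro dvd_diff) auto
    then show ?thesis
      by (simp add: cong_0_iff sum_subtractf)
  qed
  have independent: "[w a c - w b c = w a d - w b d] (mod int p)"
    if "a \<in> V" "b \<in> V" "c \<in> V" "d \<in> V" "c \<notin> {a, b}" "d \<notin> {a, b}" for a b c d
  proof (cases "a = b \<or> c = d")
    case False
    \<comment> \<open>The four vertices are distinct here and \<open>V\<close> has at least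
      \<open>k + 2\<close> elements, so \<open>k - 2\<close> others remain to form
      \<open>R\<close>.\<close>
    have "card {a, b, c, d} = 4"
      using that False by auto
    then have "k - 2 \<le> card (V - {a, b, c, d})"
      using that finV assms(4) by (subst card_Diff_subset) (auto simp: V_def)
    then obtain R where R: "R \<subseteq> V - {a, b, c, d}" "card R = k - 2"
      by (meson obtain_subset_with_card_n)
    then have finR: "finite R" and notin: "c \<notin> R" "d \<notin> R"
      using finV finite_subset by blast+
    \<comment> \<open>Extending \<open>R\<close> by \<open>c\<close> or by \<open>d\<close> gives
      two sets for \<open>exchange\<close>; the two sums differ by the term at \<open>c\<close>
      minus the term at \<open>d\<close>.\<close>
    have "[(\<Sum>y\<in>insert x R. w a y - w b y) = 0] (mod int p)" if "x \<in> {c, d}" for x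
    proof (rule exchange)
      show "insert x R \<subseteq> V - {a, b}"
        using R that \<open>c \<in> V\<close> \<open>d \<in> V\<close> \<open>c \<notin> {a, b}\<close> \<open>d \<notin> {a, b}\<close> by auto
      show "card (insert x R) = k - 1"
        using R notin finR that assms(3) by auto
    qed fact+
    from cong_diff[OF this[of c] this[of d]] show ?thesis
      using finR notin by (simp add: cong_iff_dvd_diff algebra_simps)
  qed auto
  have eq: "w a c = w b c" if "a \<in> V" "b \<in> V" "c \<in> V" "c \<notin> {a, b}" for a b c
  proof -
    have "card {a, b} \<le> 2"
      by (simp add: card_insert_if)
    then have "k - 1 \<le> card (V - {a, b})"
      using that finV assms(4) by (subst card_Diff_subset) (auto simp: V_def)
    then obtain S where S: "S \<subseteq> V - {a, b}" "card S = k - 1"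
      by (meson obtain_subset_with_card_n)
    \<comment> \<open>Every term is congruent to the one at \<open>c\<close>, whether or not
      \<open>c\<close> lies in \<open>S\<close>, so the sum amounts to \<open>k - 1\<close> copies
      of it.\<close>
    have "[(\<Sum>y\<in>S. w a y - w b y) = (\<Sum>y\<in>S. w a c - w b c)] (mod int p)"
      using S(1) that by (intro cong_sum independent) auto
    with exchange[OF S \<open>a \<in> V\<close> \<open>b \<in> V\<close>] have "[int (k - 1) * (w a c - w b c) = 0] (mod int p)"
      using S(2) by (metis cong_sym cong_trans sum_constant)
    then have "int p dvd int (k - 1) * (w a c - w b c)"
      by (simp only: cong_0_iff)
    moreover have "coprime (int p) (int (k - 1))"
      using assms(6) coprime_commute coprime_int_iff by blast
    ultimately have "int p dvd w a c - w b c"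
      using coprime_dvd_mult_right_iff by blast
    \<comment> \<open>Two indicators differ by at most 1, which is below the modulus, so congruence
      forces equality.\<close>
    moreover have "\<bar>w a c - w b c\<bar> < int p"
      using assms(5) by (simp add: w_def)
    ultimately show ?thesis
      using dvd_imp_le_int[of "w a c - w b c" "int p"] by (cases "w a c = w b c") auto
  qed
  \<comment> \<open>One endpoint is replaced at a time, passing through the pair
    \<open>{c, b}\<close>; if \<open>b = c\<close>, a single replacement suffices.\<close>
  have const: "w a b = w c d"
    if "a \<in> V" "b \<in> V" "c \<in> V" "d \<in> V" "a \<noteq> b" "c \<noteq> d" for a b c d
  proof (cases "b = c")
    case True
    then show ?thesis
      using that eq[of a d b] w_commute[of b d] by simp
  next
    case False
    then have "w a b = w c b" "w b c = w d c"
      using that by (auto intro!: eq)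
    then show ?thesis
      by (simp add: w_commute)
  qed
  show ?thesis
  proof (cases "uedges G = {}")
    case False
    then obtain e where "e \<in> uedges G" "e \<in> [V]\<^bsup>2\<^esup>"
      using assms(1) by (auto simp: simple_graph_def V_def)
    then obtain a b where ab: "a \<in> V" "b \<in> V" "a \<noteq> b" "w a b = 1"
      by (auto simp: w_def nsets_2_eq)
    have "{x, y} \<in> uedges G" if "x \<in> V" "y \<in> V" "x \<noteq> y" for x y
      using const[OF that(1,2) ab(1,2) that(3) ab(3)] ab(4) by (simp add: w_def)
    then have "[uverts G]\<^bsup>2\<^esup> \<subseteq> uedges G"
      by (auto simp: V_def nsets_2_eq)
    then show ?thesis
      using assms(1) by (auto simp: simple_graph_def)
  qed simp
qed

lemma eq_if_boolean_sum_empty: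
  assumes "tournament T" "tournament T'" "pverts T' = pverts T"
    and "uedges (boolean_sum T T') = {}"
  shows "T' = T"
proof -
  interpret T: tournament T by fact
  interpret T': tournament T' by fact
  have "(x, y) \<in> parcs T' \<longleftrightarrow> (x, y) \<in> parcs T" for x y
  proof (cases "x \<in> pverts T \<and> y \<in> pverts T \<and> x \<noteq> y")
    case True
    then show ?thesis
      using boolean_sum_edge_iff[OF assms(1-3), of x y] assms(4) by auto
  next
    \<comment> \<open>Neither tournament has loops or arcs leaving the vertex set, so both sides are
      false.\<close>
    case False
    then show ?thesis
      using assms(3) T.in_arcsD1 T.in_arcsD2 T.pair_no_loops T'.in_arcsD1 T'.in_arcsD2
        T'.pair_no_loops by fastforce
  qed
  then show ?thesis
    using assms(3) by (auto intro!: pair_pre_digraph.equality)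
qed

text \<open>Reversing every arc of \<open>T\<close> complements the boolean sum, which reduces this
  to the empty case for \<open>dual T\<close>.\<close>

lemma eq_dual_if_boolean_sum_complete:
  assumes "tournament T" "tournament T'" "pverts T' = pverts T"
    and "uedges (boolean_sum T T') = [pverts T]\<^bsup>2\<^esup>"
  shows "T' = dual T"
proof (rule eq_if_boolean_sum_empty)
  show "tournament (dual T)" "tournament T'" "pverts T' = pverts (dual T)"
    using assms tournament_dual by (simp_all add: dual_def)
  have "(x, y) \<in> parcs (dual T) \<longleftrightarrow> (x, y) \<in> parcs T'"
    if "x \<in> pverts T" "y \<in> pverts T" "x \<noteq> y" for x y
  proof -
    have "{x, y} \<in> uedges (boolean_sum T T')"
      using that assms(4) by (auto simp: nsets_2_eq)
    then show ?thesis
      using boolean_sum_edge_iff[OF assms(1-3) that] tournament.exactly_one_arc[OF assms(1) that]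
      by (auto simp: dual_def)
  qed
  then show "uedges (boolean_sum (dual T) T') = {}"
    by (auto simp: boolean_sum_def dual_def)
qed

theorem theorem5p1:
  fixes T T' :: "'a pair_pre_digraph" and G :: "'a ugraph" and V :: "'a set" and v p k :: nat
  assumes "tournament T" and "tournament T'"
    and "pverts T = V" and "pverts T' = V" and "card V = v"
    and "prime p"
    and "2 \<le> k" and "k + 2 \<le> v"
    and "G = boolean_sum T T'"
    and "\<And>K. \<lbrakk>K \<subseteq> V; card K = k\<rbrakk> \<Longrightarrow> [num_edges (induced G K) = 0] (mod p)"
  shows "(p \<ge> 3 \<and> \<not> [k = 0] (mod p) \<and> \<not> [k = 1] (mod p) \<longrightarrow> T' = T) \<and>
    (p \<ge> 3 \<and> [k = 0] (mod p) \<longrightarrow> T' = T \<or> T' = dual T) \<and>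
    (p = 2 \<and> [k = 2] (mod 4) \<longrightarrow> T' = T) \<and>
    (p = 2 \<and> [k = 0] (mod 4) \<longrightarrow> T' = T \<or> T' = dual T)"
proof -
  have verts: "pverts T' = pverts T" "uverts G = V"
    using assms(3,4,9) by (simp_all add: boolean_sum_def)
  \<comment> \<open>An infinite set has \<open>card\<close> 0, whereas \<open>v\<close> is at least
    4.\<close>
  have finV: "finite V"
    using assms(5,7,8) card.infinite by fastforce
  have empty: "T' = T" if "uedges G = {}"
    using eq_if_boolean_sum_empty[OF assms(1,2) verts(1)] that assms(9) by simp
  have complete: "T' = dual T" if "uedges G = [V]\<^bsup>2\<^esup>"
    using eq_dual_if_boolean_sum_complete[OF assms(1,2) verts(1)] that assms(3,9) by simp
  have dichotomy: "uedges G = {} \<or> uedges G = [V]\<^bsup>2\<^esup>" if "\<not> [k = 1] (mod p)"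
  proof -
    have "\<not> p dvd k - 1"
      using that assms(7) by (metis cong_altdef_nat le_trans one_le_numeral)
    then have "coprime (k - 1) p"
      using assms(6) coprime_commute prime_imp_coprime by blast
    then show ?thesis
      using empty_or_complete_if_induced_edges_cong_0[of G k p] assms(5-10) verts finV
        simple_graph_boolean_sum prime_gt_1_nat by metis
  qed
  have choose: "p dvd (k choose 2)" if "uedges G = [V]\<^bsup>2\<^esup>"
  proof -
    obtain K where K: "K \<subseteq> V" "card K = k"
      using obtain_subset_with_card_n[of k V] assms(5,8) by auto
    then have "[K]\<^bsup>2\<^esup> \<subseteq> [V]\<^bsup>2\<^esup>"
      by (simp add: nsets_mono)
    then have "num_edges (induced G K) = k choose 2"
      using that K(2) by (simp add: num_edges_def induced_def Int_absorb1)
    then show ?thesis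
      using assms(10)[OF K] by (simp add: cong_0_iff)
  qed
  \<comment> \<open>Doubling gives a product: an odd prime case splits by Euclid's lemma, and for
    \<open>p = 2\<close> evenness of the binomial becomes divisibility by 4.\<close>
  have double_choose: "2 * (k choose 2) = k * (k - 1)"
    using times_binomial_minus1_eq[of 2 k] by simp
  have odd_prime_empty: "uedges G = {}" if "\<not> [k = 0] (mod p)" "\<not> [k = 1] (mod p)"
  proof (rule ccontr)
    assume "uedges G \<noteq> {}"
    then have "p dvd 2 * (k choose 2)"
      using choose dichotomy that(2) by simp
    then have "p dvd k \<or> p dvd k - 1"
      using assms(6) prime_dvd_mult_iff double_choose by metis
    then show False
      using that assms(7) by (metis cong_0_iff cong_altdef_nat le_trans one_le_numeral)
  qed
  have not_cong_1: "\<not> [k = 1] (mod p)" if "[k = 0] (mod p)"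
  proof
    assume "[k = 1] (mod p)"
    then have "[0 = 1] (mod p)"
      using that cong_sym cong_trans by blast
    then show False
      using assms(6) by (simp add: cong_def)
  qed
  have two_empty: "uedges G = {}" if "p = 2" "[k = 2] (mod 4)"
  proof (rule ccontr)
    assume "uedges G \<noteq> {}"
    have "k mod 4 = 2"
      using that(2) by (simp add: cong_def)
    then have "[k = 0] (mod p)"
      unfolding that(1) cong_def by presburger
    then have "even (k choose 2)"
      using choose dichotomy not_cong_1 \<open>uedges G \<noteq> {}\<close> that(1) by blast
    then have "4 dvd k * (k - 1)"
      unfolding double_choose[symmetric] by auto
    \<comment> \<open>As \<open>k\<close> is even, \<open>k - 1\<close> is odd, so the whole factor
      4 must come from \<open>k\<close>, against \<open>k mod 4 = 2\<close>.\<close>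
    moreover have "coprime 4 (k - 1)"
    proof -
      have "odd (k - 1)"
        using \<open>k mod 4 = 2\<close> by presburger
      then have "coprime (2 * 2) (k - 1)"
        by (simp only: coprime_mult_left_iff coprime_left_2_iff_odd simp_thms)
      then show ?thesis
        by simp
    qed
    ultimately have "4 dvd k"
      using coprime_dvd_mult_left_iff by blast
    then show False
      using \<open>k mod 4 = 2\<close> by simp
  qed
  \<comment> \<open>Case 4 thus has \<open>k\<close> even, hence not congruent to 1 modulo 2, and
    \<open>dichotomy\<close> applies.\<close>
  have "[k = 0] (mod 2)" if "[k = 0] (mod 4)"
    using that by (auto simp: cong_0_iff elim: dvd_trans[rotated])
  then show ?thesis
    using odd_prime_empty two_empty empty complete dichotomy not_cong_1 by blast
qed

end
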